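(* Let $A$ and $B$ be integral domains, $J$ an ideal of $B$ and $f:A\to B$ an injective ring homomorphism. Then the following properties are equivalent: (1) $A\bowtie^f J$ is an Hermite ring. (2) $A\bowtie^f J$ is a Bézout ring. (3) One of the following conditions holds: - $J=B$, and $A$ and $B$ are Bézout rings; - $J\neq B$, $f(A)\cap J=0$ and $f(A)+J$ is a Bézout ring.
   Context: All rings are commutative with identity, and ring homomorphisms preserve the identity. For a ring homomorphism $f:A\to B$ and an ideal $J$ of $B$, the amalgamation of $A$ with $B$ along $J$ with respect to $f$ is the subring $A\bowtie^f J=\{(a,f(a)+j) : a\in A,\ j\in J\}$ of $A\times B$. Here $f(A)+J=\{f(a)+j : a\in A,\ j\in J\}$, which is a subring of $B$. A ring is a Bézout ring if every finitely generated ideal is principal (zero divisors are allowed). A ring $R$ is an Hermite ring if for every matrix $M$ over $R$ there exists a non-singular (i.e. invertible over $R$) square matrix $Q$ over $R$ such that $MQ$ is a triangular matrix; equivalently (a known characterization), for all $a,b\in R$ there exist $a_1,b_1,d\in R$ such that $a=a_1d$, $b=b_1d$ and $Ra_1+Rb_1=R$. *)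

theory Defs
  imports "Jordan_Normal_Form.Matrix" "HOL-Algebra.Chinese_Remainder"
begin

definition amalgamation ::
    "('a, 'm) ring_scheme \<Rightarrow> ('b, 'n) ring_scheme \<Rightarrow> ('a \<Rightarrow> 'b) \<Rightarrow> 'b set \<Rightarrow> ('a \<times> 'b) ring" where
  "amalgamation A B f J =
     (RDirProd A B)\<lparr>carrier := {(a, f a \<oplus>\<^bsub>B\<^esub> j) | a j. a \<in> carrier A \<and> j \<in> J}\<rparr>"

definition image_plus_ideal ::
    "('a, 'm) ring_scheme \<Rightarrow> ('b, 'n) ring_scheme \<Rightarrow> ('a \<Rightarrow> 'b) \<Rightarrow> 'b set \<Rightarrow> ('b, 'n) ring_scheme" where
  "image_plus_ideal A B f J =
     B\<lparr>carrier := {f a \<oplus>\<^bsub>B\<^esub> j | a j. a \<in> carrier A \<and> j \<in> J}\<rparr>"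

locale bezout_ring = cring +
  assumes finitely_generated_principal:
    "\<lbrakk>ideal I R; finite S; S \<subseteq> carrier R; I = Idl\<^bsub>R\<^esub> S\<rbrakk> \<Longrightarrow> principalideal I R"

text \<open>
  The matrix operations of the imported matrix library take ring operations from type classes.
  The counterparts below take them from the record \<open>R\<close>, whose elements need not exhaust the
  underlying type.
\<close>

definition matrices_over :: "('a, 'm) ring_scheme \<Rightarrow> nat \<Rightarrow> nat \<Rightarrow> 'a mat set" where
  "matrices_over R m n = {M \<in> carrier_mat m n. elements_mat M \<subseteq> carrier R}"

definition matrix_mult :: "('a, 'm) ring_scheme \<Rightarrow> 'a mat \<Rightarrow> 'a mat \<Rightarrow> 'a mat" where
  "matrix_mult R M N = mat (dim_row M) (dim_col N)
     (\<lambda>(i, j). \<Oplus>\<^bsub>R\<^esub>k \<in> {..<dim_col M}. M $$ (i, k) \<otimes>\<^bsub>R\<^esub> N $$ (k, j))"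

definition identity_matrix :: "('a, 'm) ring_scheme \<Rightarrow> nat \<Rightarrow> 'a mat" where
  "identity_matrix R n = mat n n (\<lambda>(i, j). if i = j then \<one>\<^bsub>R\<^esub> else \<zero>\<^bsub>R\<^esub>)"

definition nonsingular_matrix :: "('a, 'm) ring_scheme \<Rightarrow> nat \<Rightarrow> 'a mat \<Rightarrow> bool" where
  "nonsingular_matrix R n Q \<longleftrightarrow> Q \<in> matrices_over R n n \<and>
     (\<exists>P \<in> matrices_over R n n.
        matrix_mult R P Q = identity_matrix R n \<and> matrix_mult R Q P = identity_matrix R n)"

text \<open>
  Triangular means lower triangular, that is, zero above the main diagonal, also for rectangular
  matrices. With upper triangularity instead, every matrix with a single row would already be
  triangular.
\<close>

definition triangular_matrix :: "('a, 'm) ring_scheme \<Rightarrow> 'a mat \<Rightarrow> bool" where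
  "triangular_matrix R M \<longleftrightarrow> (\<forall>i < dim_row M. \<forall>j < dim_col M. i < j \<longrightarrow> M $$ (i, j) = \<zero>\<^bsub>R\<^esub>)"

locale hermite_ring = cring +
  assumes triangular_reduction:
    "M \<in> matrices_over R m n \<Longrightarrow>
       \<exists>Q. nonsingular_matrix R n Q \<and> triangular_matrix R (matrix_mult R M Q)"

end

theory Submission
  imports Defs "HOL-Algebra.Subrings"
begin

text \<open>
  Triangularising a single row shows that Hermite rings are Bezout. In the other direction, the
  intermediate property is that any two elements factor as \<open>a = a1 d\<close>, \<open>b = b1 d\<close> with
  \<open>u a1 + v b1 = 1\<close>: column operations with the unimodular matrix \<open>((u, -b1), (v, a1))\<close> then replace
  \<open>(a, b)\<close> by \<open>(d, 0)\<close>. Bezout domains have this property, and it passes to products and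
  isomorphic rings. The amalgamation is \<open>A \<times> B\<close> if \<open>J = B\<close>, and the projection to the second
  component is an isomorphism onto \<open>f(A) + J\<close> if \<open>f(A) \<inter> J = 0\<close>. In the remaining case
  it is not Bezout: for \<open>0 \<noteq> f a \<in> J\<close> the ideal spanned by \<open>(a, 0)\<close> and \<open>(0, f a)\<close> is not principal.
\<close>

section \<open>Matrices over a ring record\<close>

lemma matrices_overI:
  assumes "dim_row M = m" and "dim_col M = n"
    and "\<And>i j. \<lbrakk>i < m; j < n\<rbrakk> \<Longrightarrow> M $$ (i, j) \<in> carrier R"
  shows "M \<in> matrices_over R m n"
proof -
  have "a \<in> carrier R" if "a \<in> elements_mat M" for a
    using elements_matD[OF that] assms by blast
  then show ?thesis
    using assms(1,2) unfolding matrices_over_def by (blast intro: carrier_matI)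
qed

lemma matrices_overD:
  assumes "M \<in> matrices_over R m n"
  shows "dim_row M = m" and "dim_col M = n"
    and "\<And>i j. \<lbrakk>i < m; j < n\<rbrakk> \<Longrightarrow> M $$ (i, j) \<in> carrier R"
proof -
  have M: "M \<in> carrier_mat m n" "elements_mat M \<subseteq> carrier R"
    using assms unfolding matrices_over_def by blast+
  show "dim_row M = m" "dim_col M = n" using carrier_matD[OF M(1)] by simp_all
  show "M $$ (i, j) \<in> carrier R" if "i < m" "j < n" for i j
    using elements_matI[OF M(1) that refl] M(2) by blast
qed

text \<open>Induction on \<open>I\<close>; the step is additivity of sums over \<open>K\<close>.
  This interchange is what makes \<open>matrix_mult\<close> associative.\<close>

lemma (in cring) finsum_swap:
  assumes "finite I" and "finite K" and "\<And>i k. \<lbrakk>i \<in> I; k \<in> K\<rbrakk> \<Longrightarrow> g i k \<in> carrier R"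
  shows "(\<Oplus>i\<in>I. \<Oplus>k\<in>K. g i k) = (\<Oplus>k\<in>K. \<Oplus>i\<in>I. g i k)"
  using assms(1,3)
proof (induction I rule: finite_induct)
  case empty
  then show ?case by (simp add: add.finprod_one_eqI)
next
  case (insert x I)
  have "(\<Oplus>k\<in>K. \<Oplus>i\<in>insert x I. g i k) = (\<Oplus>k\<in>K. g x k \<oplus> (\<Oplus>i\<in>I. g i k))"
    by (rule finsum_cong') (use insert in \<open>auto intro!: add.finprod_closed\<close>)
  also have "\<dots> = (\<Oplus>k\<in>K. g x k) \<oplus> (\<Oplus>k\<in>K. \<Oplus>i\<in>I. g i k)"
    by (rule finsum_addf) (use insert in \<open>auto intro!: add.finprod_closed\<close>)
  also have "\<dots> = (\<Oplus>i\<in>insert x I. \<Oplus>k\<in>K. g i k)"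
    using insert by (subst add.finprod_insert) (auto intro!: add.finprod_closed)
  finally show ?case by simp
qed

lemma (in cring) finsum_eq_single:
  assumes "finite I" and "i \<in> I" and "g i \<in> carrier R"
    and "\<And>k. \<lbrakk>k \<in> I; k \<noteq> i\<rbrakk> \<Longrightarrow> g k = \<zero>"
  shows "(\<Oplus>k\<in>I. g k) = g i"
proof -
  have "(\<Oplus>k\<in>I. g k) = (\<Oplus>k\<in>{i}. g k)"
    by (rule add.finprod_mono_neutral_cong_right) (use assms in \<open>auto, metis zero_closed\<close>)
  then show ?thesis using assms by simp
qed

text \<open>Needed for column operations that mix exactly two columns.\<close>

lemma (in cring) finsum_eq_pair:
  assumes "finite I" and "i \<in> I" and "j \<in> I" and "i \<noteq> j"
    and "g i \<in> carrier R" and "g j \<in> carrier R"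
    and "\<And>k. \<lbrakk>k \<in> I; k \<noteq> i; k \<noteq> j\<rbrakk> \<Longrightarrow> g k = \<zero>"
  shows "(\<Oplus>k\<in>I. g k) = g i \<oplus> g j"
proof -
  have "(\<Oplus>k\<in>I. g k) = (\<Oplus>k\<in>{i, j}. g k)"
    by (rule add.finprod_mono_neutral_cong_right) (use assms in \<open>auto, metis zero_closed\<close>)
  then show ?thesis using assms by simp
qed

section \<open>Matrix algebra: associativity, identity and invertibility\<close>

context cring
begin

lemma matrix_mult_entry:
  assumes "M \<in> matrices_over R m n" and "N \<in> matrices_over R n l" and "i < m" and "j < l"
  shows "matrix_mult R M N $$ (i, j) = (\<Oplus>k\<in>{..<n}. M $$ (i, k) \<otimes> N $$ (k, j))"
  using assms unfolding matrix_mult_def by (simp add: matrices_overD)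

lemma matrix_mult_closed:
  assumes "M \<in> matrices_over R m n" and "N \<in> matrices_over R n l"
  shows "matrix_mult R M N \<in> matrices_over R m l"
proof (rule matrices_overI)
  show "dim_row (matrix_mult R M N) = m" "dim_col (matrix_mult R M N) = l"
    using assms unfolding matrix_mult_def by (simp_all add: matrices_overD)
next
  fix i j assume "i < m" "j < l"
  then show "matrix_mult R M N $$ (i, j) \<in> carrier R"
    using assms by (auto simp: matrix_mult_entry[OF assms] matrices_overD intro!: add.finprod_closed)
qed

lemma identity_matrix_closed: "identity_matrix R n \<in> matrices_over R n n"
  by (rule matrices_overI) (auto simp: identity_matrix_def)

lemma matrix_eqI:
  assumes "M \<in> matrices_over R m n" and "N \<in> matrices_over R m n"
    and "\<And>i j. \<lbrakk>i < m; j < n\<rbrakk> \<Longrightarrow> M $$ (i, j) = N $$ (i, j)"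
  shows "M = N"
  by (rule eq_matI) (use assms in \<open>auto simp: matrices_overD\<close>)

text \<open>Distributivity turns both sides into double sums of the same triple products, taken in
  opposite orders of summation.\<close>

lemma matrix_mult_assoc:
  assumes M: "M \<in> matrices_over R m n" and N: "N \<in> matrices_over R n k"
    and L: "L \<in> matrices_over R k l"
  shows "matrix_mult R (matrix_mult R M N) L = matrix_mult R M (matrix_mult R N L)"
proof (rule matrix_eqI)
  note MN = matrix_mult_closed[OF M N] and NL = matrix_mult_closed[OF N L]
  show "matrix_mult R (matrix_mult R M N) L \<in> matrices_over R m l"
    by (rule matrix_mult_closed[OF MN L])
  show "matrix_mult R M (matrix_mult R N L) \<in> matrices_over R m l"
    by (rule matrix_mult_closed[OF M NL])
  fix i j assume ij: "i < m" "j < l"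
  note closed = matrices_overD(3)[OF M] matrices_overD(3)[OF N] matrices_overD(3)[OF L]
  have "matrix_mult R (matrix_mult R M N) L $$ (i, j) =
      (\<Oplus>t\<in>{..<k}. (\<Oplus>s\<in>{..<n}. M $$ (i, s) \<otimes> N $$ (s, t)) \<otimes> L $$ (t, j))"
    unfolding matrix_mult_entry[OF MN L ij] using ij
    by (intro finsum_cong') (auto simp: matrix_mult_entry[OF M N] closed intro!: add.finprod_closed)
  also have "\<dots> = (\<Oplus>t\<in>{..<k}. \<Oplus>s\<in>{..<n}. M $$ (i, s) \<otimes> N $$ (s, t) \<otimes> L $$ (t, j))"
    using ij by (intro finsum_cong') (auto simp: closed finsum_ldistr intro!: add.finprod_closed)
  also have "\<dots> = (\<Oplus>s\<in>{..<n}. \<Oplus>t\<in>{..<k}. M $$ (i, s) \<otimes> N $$ (s, t) \<otimes> L $$ (t, j))"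
    using ij by (intro finsum_swap) (auto simp: closed)
  also have "\<dots> = (\<Oplus>s\<in>{..<n}. M $$ (i, s) \<otimes> (\<Oplus>t\<in>{..<k}. N $$ (s, t) \<otimes> L $$ (t, j)))"
    using ij by (intro finsum_cong')
      (auto simp: closed finsum_rdistr m_assoc intro!: add.finprod_closed finsum_cong')
  also have "\<dots> = matrix_mult R M (matrix_mult R N L) $$ (i, j)"
    unfolding matrix_mult_entry[OF M NL ij] using ij
    by (intro finsum_cong') (auto simp: matrix_mult_entry[OF N L] closed intro!: add.finprod_closed)
  finally show "matrix_mult R (matrix_mult R M N) L $$ (i, j)
      = matrix_mult R M (matrix_mult R N L) $$ (i, j)" .
qed

lemma matrix_mult_identity_right:
  assumes M: "M \<in> matrices_over R m n"
  shows "matrix_mult R M (identity_matrix R n) = M"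
proof (rule matrix_eqI[OF matrix_mult_closed[OF M identity_matrix_closed] M])
  fix i j assume ij: "i < m" "j < n"
  have "(\<Oplus>k\<in>{..<n}. M $$ (i, k) \<otimes> identity_matrix R n $$ (k, j))
      = M $$ (i, j) \<otimes> identity_matrix R n $$ (j, j)"
    by (rule finsum_eq_single)
      (use ij matrices_overD(3)[OF M] in \<open>auto simp: identity_matrix_def\<close>)
  then show "matrix_mult R M (identity_matrix R n) $$ (i, j) = M $$ (i, j)"
    using ij matrices_overD(3)[OF M]
    by (simp add: matrix_mult_entry[OF M identity_matrix_closed]) (simp add: identity_matrix_def)
qed

lemma matrix_mult_identity_left:
  assumes M: "M \<in> matrices_over R m n"
  shows "matrix_mult R (identity_matrix R m) M = M"
proof (rule matrix_eqI[OF matrix_mult_closed[OF identity_matrix_closed M] M])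
  fix i j assume ij: "i < m" "j < n"
  have "(\<Oplus>k\<in>{..<m}. identity_matrix R m $$ (i, k) \<otimes> M $$ (k, j))
      = identity_matrix R m $$ (i, i) \<otimes> M $$ (i, j)"
    by (rule finsum_eq_single)
      (use ij matrices_overD(3)[OF M] in \<open>auto simp: identity_matrix_def\<close>)
  then show "matrix_mult R (identity_matrix R m) M $$ (i, j) = M $$ (i, j)"
    using ij matrices_overD(3)[OF M]
    by (simp add: matrix_mult_entry[OF identity_matrix_closed M]) (simp add: identity_matrix_def)
qed

lemma nonsingular_identity: "nonsingular_matrix R n (identity_matrix R n)"
  unfolding nonsingular_matrix_def
  using identity_matrix_closed matrix_mult_identity_left by blast

text \<open>Inverses multiply in reverse order. This lets successive column operations be collected
  into one invertible matrix.\<close>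

lemma nonsingular_matrix_mult:
  assumes "nonsingular_matrix R n Q" and "nonsingular_matrix R n Q'"
  shows "nonsingular_matrix R n (matrix_mult R Q Q')"
proof -
  \<comment> \<open>Stated for one-sided inverses, so that it yields both products required of an
    inverse when the roles are exchanged.\<close>
  have cancel: "matrix_mult R (matrix_mult R X Y) (matrix_mult R Y' X') = identity_matrix R n"
    if "X \<in> matrices_over R n n" "Y \<in> matrices_over R n n"
      "X' \<in> matrices_over R n n" "Y' \<in> matrices_over R n n"
      "matrix_mult R X X' = identity_matrix R n" "matrix_mult R Y Y' = identity_matrix R n"
    for X X' Y Y'
  proof -
    have "matrix_mult R (matrix_mult R X Y) (matrix_mult R Y' X')
        = matrix_mult R X (matrix_mult R (matrix_mult R Y Y') X')"
      by (simp only: matrix_mult_assoc[OF that(1,2) matrix_mult_closed[OF that(4,3)]]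
          matrix_mult_assoc[OF that(2,4,3)])
    then show ?thesis
      by (simp only: that(5,6) matrix_mult_identity_left[OF that(3)])
  qed
  obtain P P' where Q: "Q \<in> matrices_over R n n" "P \<in> matrices_over R n n"
      "matrix_mult R P Q = identity_matrix R n" "matrix_mult R Q P = identity_matrix R n"
    and Q': "Q' \<in> matrices_over R n n" "P' \<in> matrices_over R n n"
      "matrix_mult R P' Q' = identity_matrix R n" "matrix_mult R Q' P' = identity_matrix R n"
    using assms unfolding nonsingular_matrix_def by blast
  show ?thesis
    unfolding nonsingular_matrix_def
  proof (intro conjI bexI)
    show "matrix_mult R (matrix_mult R P' P) (matrix_mult R Q Q') = identity_matrix R n"
      by (rule cancel[OF Q'(2) Q(2) Q'(1) Q(1) Q'(3) Q(3)])
    show "matrix_mult R (matrix_mult R Q Q') (matrix_mult R P' P) = identity_matrix R n"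
      by (rule cancel[OF Q(1) Q'(1) Q(2) Q'(2) Q(4) Q'(4)])
  qed (rule matrix_mult_closed[OF Q(1) Q'(1)], rule matrix_mult_closed[OF Q'(2) Q(2)])
qed

end

section \<open>Triangular reduction\<close>

text \<open>The identity matrix with the block \<open>((a, b), (c, d))\<close> placed in rows and
  columns \<open>p\<close> and \<open>q\<close>. Multiplying by it on the right recombines columns
  \<open>p\<close> and \<open>q\<close>.\<close>

definition plane_matrix ::
    "('a, 'm) ring_scheme \<Rightarrow> nat \<Rightarrow> nat \<Rightarrow> nat \<Rightarrow> 'a \<Rightarrow> 'a \<Rightarrow> 'a \<Rightarrow> 'a \<Rightarrow> 'a mat" where
  "plane_matrix R n p q a b c d = mat n n (\<lambda>(i, j).
     if i = p \<and> j = p then a else if i = p \<and> j = q then b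
     else if i = q \<and> j = p then c else if i = q \<and> j = q then d
     else if i = j then \<one>\<^bsub>R\<^esub> else \<zero>\<^bsub>R\<^esub>)"

text \<open>The elementwise characterization of Hermite rings. That \<open>a1\<close> and
  \<open>b1\<close> generate the unit ideal is spelled out with coefficients \<open>u\<close> and
  \<open>v\<close>, since these become matrix entries.\<close>

definition unimodular_factorization :: "('a, 'm) ring_scheme \<Rightarrow> bool" where
  "unimodular_factorization R \<longleftrightarrow> (\<forall>a \<in> carrier R. \<forall>b \<in> carrier R.
     \<exists>a1 \<in> carrier R. \<exists>b1 \<in> carrier R. \<exists>d \<in> carrier R. \<exists>u \<in> carrier R. \<exists>v \<in> carrier R.
       a = a1 \<otimes>\<^bsub>R\<^esub> d \<and> b = b1 \<otimes>\<^bsub>R\<^esub> d \<and> u \<otimes>\<^bsub>R\<^esub> a1 \<oplus>\<^bsub>R\<^esub> v \<otimes>\<^bsub>R\<^esub> b1 = \<one>\<^bsub>R\<^esub>)"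

lemma unimodular_factorizationE:
  assumes "unimodular_factorization R" and "a \<in> carrier R" and "b \<in> carrier R"
  obtains a1 b1 d u v where "a1 \<in> carrier R" and "b1 \<in> carrier R" and "d \<in> carrier R"
    and "u \<in> carrier R" and "v \<in> carrier R"
    and "a = a1 \<otimes>\<^bsub>R\<^esub> d" and "b = b1 \<otimes>\<^bsub>R\<^esub> d"
    and "u \<otimes>\<^bsub>R\<^esub> a1 \<oplus>\<^bsub>R\<^esub> v \<otimes>\<^bsub>R\<^esub> b1 = \<one>\<^bsub>R\<^esub>"
  using bspec[OF bspec[OF assms(1)[unfolded unimodular_factorization_def] assms(2)] assms(3)]
  by (elim bexE conjE) (rule that)

section \<open>Operations on two columns and row-by-row elimination\<close>

context cring
begin

lemma plane_matrix_closed: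
  assumes "a \<in> carrier R" and "b \<in> carrier R" and "c \<in> carrier R" and "d \<in> carrier R"
  shows "plane_matrix R n p q a b c d \<in> matrices_over R n n"
  by (rule matrices_overI) (use assms in \<open>auto simp: plane_matrix_def\<close>)

text \<open>Columns \<open>p\<close> and \<open>q\<close> of the plane matrix are supported on rows
  \<open>p\<close> and \<open>q\<close>; any other column is a column of the identity
  matrix.\<close>

lemma mult_plane_matrix_entry:
  assumes M: "M \<in> matrices_over R m n" and pq: "p < n" "q < n" "p \<noteq> q"
    and abcd: "a \<in> carrier R" "b \<in> carrier R" "c \<in> carrier R" "d \<in> carrier R"
    and ij: "i < m" "j < n"
  shows "matrix_mult R M (plane_matrix R n p q a b c d) $$ (i, j) =
    (if j = p then M $$ (i, p) \<otimes> a \<oplus> M $$ (i, q) \<otimes> c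
     else if j = q then M $$ (i, p) \<otimes> b \<oplus> M $$ (i, q) \<otimes> d else M $$ (i, j))"
proof -
  let ?E = "plane_matrix R n p q a b c d"
  let ?g = "\<lambda>k. M $$ (i, k) \<otimes> ?E $$ (k, j)"
  note entry = matrix_mult_entry[OF M plane_matrix_closed[OF abcd] ij]
  note Mc = matrices_overD(3)[OF M ij(1)]
  show ?thesis
  proof (cases "j = p \<or> j = q")
    case True
    have "(\<Oplus>k\<in>{..<n}. ?g k) = ?g p \<oplus> ?g q"
      by (rule finsum_eq_pair) (use True pq abcd ij Mc in \<open>auto simp: plane_matrix_def\<close>)
    then show ?thesis
      using True pq ij unfolding entry by (auto simp: plane_matrix_def)
  next
    case False
    have "(\<Oplus>k\<in>{..<n}. ?g k) = ?g j"
      by (rule finsum_eq_single) (use False pq abcd ij Mc in \<open>auto simp: plane_matrix_def\<close>)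
    then show ?thesis
      using False pq ij Mc unfolding entry by (auto simp: plane_matrix_def)
  qed
qed

text \<open>A block of determinant one is inverted by its adjugate.\<close>

lemma plane_matrix_inverse:
  assumes pq: "p < n" "q < n" "p \<noteq> q"
    and abcd: "a \<in> carrier R" "b \<in> carrier R" "c \<in> carrier R" "d \<in> carrier R"
    and det: "a \<otimes> d \<ominus> b \<otimes> c = \<one>"
  shows "matrix_mult R (plane_matrix R n p q a b c d) (plane_matrix R n p q d (\<ominus> b) (\<ominus> c) a)
    = identity_matrix R n"
proof (rule matrix_eqI)
  note E = plane_matrix_closed[OF abcd, of n p q]
  have abcd': "d \<in> carrier R" "\<ominus> b \<in> carrier R" "\<ominus> c \<in> carrier R" "a \<in> carrier R"
    using abcd by auto
  show "matrix_mult R (plane_matrix R n p q a b c d) (plane_matrix R n p q d (\<ominus> b) (\<ominus> c) a)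
      \<in> matrices_over R n n"
    by (rule matrix_mult_closed[OF E plane_matrix_closed[OF abcd']])
  show "identity_matrix R n \<in> matrices_over R n n" by (rule identity_matrix_closed)
  \<comment> \<open>The four entries of the block times its adjugate.\<close>
  have e: "a \<otimes> d \<oplus> b \<otimes> (\<ominus> c) = \<one>" "a \<otimes> (\<ominus> b) \<oplus> b \<otimes> a = \<zero>"
    "c \<otimes> d \<oplus> d \<otimes> (\<ominus> c) = \<zero>" "c \<otimes> (\<ominus> b) \<oplus> d \<otimes> a = \<one>"
    using det abcd by algebra+
  fix i j assume ij: "i < n" "j < n"
  show "matrix_mult R (plane_matrix R n p q a b c d) (plane_matrix R n p q d (\<ominus> b) (\<ominus> c) a)
      $$ (i, j) = identity_matrix R n $$ (i, j)"
    unfolding mult_plane_matrix_entry[OF E pq abcd' ij]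
    using ij pq abcd e by (auto simp: plane_matrix_def identity_matrix_def)
qed

lemma nonsingular_plane_matrix:
  assumes pq: "p < n" "q < n" "p \<noteq> q"
    and abcd: "a \<in> carrier R" "b \<in> carrier R" "c \<in> carrier R" "d \<in> carrier R"
    and det: "a \<otimes> d \<ominus> b \<otimes> c = \<one>"
  shows "nonsingular_matrix R n (plane_matrix R n p q a b c d)"
proof -
  let ?E = "plane_matrix R n p q a b c d" and ?F = "plane_matrix R n p q d (\<ominus> b) (\<ominus> c) a"
  have det': "d \<otimes> a \<ominus> (\<ominus> b) \<otimes> (\<ominus> c) = \<one>"
    using det abcd by algebra
  \<comment> \<open>The adjugate again has determinant one, and its own adjugate is the original
    block.\<close>
  have "matrix_mult R ?F ?E = identity_matrix R n"
    using plane_matrix_inverse[OF pq _ _ _ _ det'] abcd by simp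
  moreover have "matrix_mult R ?E ?F = identity_matrix R n"
    by (rule plane_matrix_inverse[OF pq abcd det])
  ultimately show ?thesis
    unfolding nonsingular_matrix_def using abcd by (meson a_inv_closed plane_matrix_closed)
qed

text \<open>The last two conclusions record what the operation preserves: all other columns, and the
  zeros of a row that vanishes in both columns. They protect the zeros produced earlier in the
  elimination.\<close>

lemma plane_reduction:
  assumes P: "unimodular_factorization R" and M: "M \<in> matrices_over R m n"
    and "i < m" and pq: "p < n" "q < n" "p \<noteq> q"
  obtains Q where "nonsingular_matrix R n Q"
    and "matrix_mult R M Q $$ (i, q) = \<zero>"
    and "\<And>r j. \<lbrakk>r < m; j < n; j \<noteq> p; j \<noteq> q\<rbrakk> \<Longrightarrow> matrix_mult R M Q $$ (r, j) = M $$ (r, j)"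
    and "\<And>r j. \<lbrakk>r < m; j \<in> {p, q}; M $$ (r, p) = \<zero>; M $$ (r, q) = \<zero>\<rbrakk>
      \<Longrightarrow> matrix_mult R M Q $$ (r, j) = \<zero>"
proof -
  have ab: "M $$ (i, p) \<in> carrier R" "M $$ (i, q) \<in> carrier R"
    using matrices_overD(3)[OF M] \<open>i < m\<close> pq by auto
  obtain a1 b1 d u v where c: "a1 \<in> carrier R" "b1 \<in> carrier R" "d \<in> carrier R"
      "u \<in> carrier R" "v \<in> carrier R"
    and eq: "M $$ (i, p) = a1 \<otimes> d" "M $$ (i, q) = b1 \<otimes> d" "u \<otimes> a1 \<oplus> v \<otimes> b1 = \<one>"
    by (rule unimodular_factorizationE[OF P ab])
  have c': "u \<in> carrier R" "\<ominus> b1 \<in> carrier R" "v \<in> carrier R" "a1 \<in> carrier R"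
    using c by auto
  have det: "u \<otimes> a1 \<ominus> (\<ominus> b1) \<otimes> v = \<one>"
    using c eq(3) by algebra
  have z: "a1 \<otimes> d \<otimes> (\<ominus> b1) \<oplus> b1 \<otimes> d \<otimes> a1 = \<zero>"
    using c by algebra
  note entry = mult_plane_matrix_entry[OF M pq c']
  show thesis
    by (rule that[OF nonsingular_plane_matrix[OF pq c' det]])
      (use \<open>i < m\<close> pq c' eq z in \<open>auto simp: entry\<close>)
qed

text \<open>
  The state of the elimination while row \<open>i\<close> is being processed: the rows above it are triangular,
  and in row \<open>i\<close> the entries right of the diagonal are zero up to column \<open>k\<close> (exclusive).
\<close>

definition cleared_before :: "nat \<Rightarrow> nat \<Rightarrow> 'a mat \<Rightarrow> bool" where
  "cleared_before i k M \<longleftrightarrow> (\<forall>r < dim_row M. \<forall>j < dim_col M. r < j \<longrightarrow>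
     r < i \<or> r = i \<and> j < k \<longrightarrow> M $$ (r, j) = \<zero>)"

text \<open>Column \<open>i\<close> is the pivot column, combined with column \<open>k\<close>. In a
  row above \<open>i\<close> both columns lie right of the diagonal, so they already vanish there
  and stay zero; in row \<open>i\<close> the columns strictly between are untouched.\<close>

lemma clear_entry:
  assumes P: "unimodular_factorization R" and M: "M \<in> matrices_over R m n"
    and ik: "i < m" "i < k" "k < n" and cl: "cleared_before i k M"
  obtains Q where "nonsingular_matrix R n Q" and "cleared_before i (Suc k) (matrix_mult R M Q)"
proof -
  have "i < n" "i \<noteq> k" using ik by auto
  obtain Q where Q: "nonsingular_matrix R n Q"
    and z: "matrix_mult R M Q $$ (i, k) = \<zero>"
    and same: "\<And>r j. \<lbrakk>r < m; j < n; j \<noteq> i; j \<noteq> k\<rbrakk> \<Longrightarrow> matrix_mult R M Q $$ (r, j) = M $$ (r, j)"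
    and zz: "\<And>r j. \<lbrakk>r < m; j \<in> {i, k}; M $$ (r, i) = \<zero>; M $$ (r, k) = \<zero>\<rbrakk>
      \<Longrightarrow> matrix_mult R M Q $$ (r, j) = \<zero>"
    using plane_reduction[OF P M \<open>i < m\<close> \<open>i < n\<close> \<open>k < n\<close> \<open>i \<noteq> k\<close>] by blast
  have MQ: "matrix_mult R M Q \<in> matrices_over R m n"
    using matrix_mult_closed[OF M] Q unfolding nonsingular_matrix_def by blast
  have M0: "M $$ (r, j) = \<zero>" if "r < m" "j < n" "r < j" "r < i \<or> r = i \<and> j < k" for r j
    using cl that unfolding cleared_before_def by (auto simp: matrices_overD[OF M])
  have "matrix_mult R M Q $$ (r, j) = \<zero>"
    if "r < m" "j < n" "r < j" "r < i \<or> r = i \<and> j < Suc k" for r j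
  proof (cases "r < i")
    case True
    then have "M $$ (r, i) = \<zero>" "M $$ (r, k) = \<zero>" "M $$ (r, j) = \<zero>"
      using M0 that ik by auto
    then show ?thesis using same[OF that(1,2)] zz[OF that(1), of j] by fastforce
  next
    case False
    then have "r = i" "j = k \<or> j < k" using that by auto
    then show ?thesis using z same[OF that(1,2)] M0 that by auto
  qed
  then have "cleared_before i (Suc k) (matrix_mult R M Q)"
    unfolding cleared_before_def by (simp add: matrices_overD[OF MQ])
  then show thesis using that Q by blast
qed

lemma clear_row:
  assumes P: "unimodular_factorization R" and M: "M \<in> matrices_over R m n"
    and "i < m" and cl: "cleared_before i (Suc i) M"
  shows "k \<le> n \<Longrightarrow> \<exists>Q. nonsingular_matrix R n Q \<and> cleared_before i k (matrix_mult R M Q)"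
proof (induction k)
  case 0
  \<comment> \<open>With \<open>k = 0\<close> only the rows above \<open>i\<close> matter, and the
    identity matrix suffices.\<close>
  show ?case
    using nonsingular_identity cl unfolding cleared_before_def
    by (metis matrix_mult_identity_right[OF M] not_less_zero less_SucI)
next
  case (Suc k)
  then obtain Q where Q: "nonsingular_matrix R n Q" and clQ: "cleared_before i k (matrix_mult R M Q)"
    by auto
  have Qc: "Q \<in> matrices_over R n n" using Q unfolding nonsingular_matrix_def by blast
  note MQ = matrix_mult_closed[OF M Qc]
  show ?case
  proof (cases "i < k")
    case True
    obtain Q' where Q': "nonsingular_matrix R n Q'"
      and cl': "cleared_before i (Suc k) (matrix_mult R (matrix_mult R M Q) Q')"
      using clear_entry[OF P MQ \<open>i < m\<close> True _ clQ] Suc.prems by auto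
    have "Q' \<in> matrices_over R n n" using Q' unfolding nonsingular_matrix_def by blast
    then show ?thesis
      using nonsingular_matrix_mult[OF Q Q'] cl' matrix_mult_assoc[OF M Qc] by metis
  next
    \<comment> \<open>Here \<open>k \<le> i\<close>, so column \<open>k\<close> is not right of the
      diagonal in row \<open>i\<close> and nothing has to be cleared.\<close>
    case False
    then have "cleared_before i (Suc k) (matrix_mult R M Q)"
      using clQ unfolding cleared_before_def by auto
    then show ?thesis using Q by blast
  qed
qed

text \<open>Induction on the number of finished rows. The bound \<open>0\<close> in
  \<open>cleared_before i 0\<close> means that row \<open>i\<close> itself is not yet
  constrained.\<close>

lemma clear_rows:
  assumes P: "unimodular_factorization R" and M: "M \<in> matrices_over R m n"
  shows "i \<le> m \<Longrightarrow> \<exists>Q. nonsingular_matrix R n Q \<and> cleared_before i 0 (matrix_mult R M Q)"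
proof (induction i)
  case 0
  show ?case using nonsingular_identity[of n] by (auto simp: cleared_before_def)
next
  case (Suc i)
  then obtain Q where Q: "nonsingular_matrix R n Q" and clQ: "cleared_before i 0 (matrix_mult R M Q)"
    by auto
  have Qc: "Q \<in> matrices_over R n n" using Q unfolding nonsingular_matrix_def by blast
  note MQ = matrix_mult_closed[OF M Qc]
  \<comment> \<open>No column index lies strictly between \<open>i\<close> and \<open>Suc i\<close>,
    so row \<open>i\<close> contributes no condition.\<close>
  have "cleared_before i (Suc i) (matrix_mult R M Q)"
    using clQ unfolding cleared_before_def by auto
  then obtain Q' where Q': "nonsingular_matrix R n Q'"
    and cl': "cleared_before i n (matrix_mult R (matrix_mult R M Q) Q')"
    using clear_row[OF P MQ, of i n] Suc.prems by auto
  have Qc': "Q' \<in> matrices_over R n n" using Q' unfolding nonsingular_matrix_def by blast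
  \<comment> \<open>Clearing row \<open>i\<close> up to column \<open>n\<close> finishes it.\<close>
  have "cleared_before (Suc i) 0 (matrix_mult R (matrix_mult R M Q) Q')"
    using cl' unfolding cleared_before_def
    by (auto simp: matrices_overD[OF matrix_mult_closed[OF MQ Qc']] less_Suc_eq)
  then show ?case
    using nonsingular_matrix_mult[OF Q Q'] matrix_mult_assoc[OF M Qc Qc'] by metis
qed

lemma hermite_ring_if_unimodular_factorization:
  assumes "unimodular_factorization R"
  shows "hermite_ring R"
proof unfold_locales
  fix M m n assume M: "M \<in> matrices_over R m n"
  obtain Q where Q: "nonsingular_matrix R n Q" and cl: "cleared_before m 0 (matrix_mult R M Q)"
    using clear_rows[OF assms M le_refl] by blast
  have Qc: "Q \<in> matrices_over R n n" using Q unfolding nonsingular_matrix_def by blast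
  have "triangular_matrix R (matrix_mult R M Q)"
    using cl unfolding cleared_before_def triangular_matrix_def
    by (simp add: matrices_overD[OF matrix_mult_closed[OF M Qc]])
  then show "\<exists>Q. nonsingular_matrix R n Q \<and> triangular_matrix R (matrix_mult R M Q)"
    using Q by blast
qed

end

section \<open>Bezout and Hermite rings\<close>

lemma (in ideal) finsum_mem:
  assumes "finite K" and "g \<in> K \<rightarrow> I"
  shows "(\<Oplus>k\<in>K. g k) \<in> I"
  using assms
proof (induction K rule: finite_induct)
  case (insert x K)
  then have "g \<in> K \<rightarrow> carrier R" "g x \<in> carrier R"
    by (auto simp: Pi_iff intro: Icarr)
  then show ?case using insert by (simp add: Pi_iff)
qed simp

text \<open>With the generators written as a single row \<open>M\<close>, a triangular product
  \<open>M Q\<close> is a row \<open>(d, 0, ..., 0)\<close>. Its entry \<open>d\<close> is a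
  combination of the generators, and \<open>M = (M Q) P\<close> makes each generator a multiple of
  \<open>d\<close>.\<close>

lemma (in hermite_ring) bezout_ring: "bezout_ring R"
proof (rule bezout_ring.intro[OF is_cring bezout_ring_axioms.intro])
  fix I S assume I: "ideal I R" and S: "finite S" "S \<subseteq> carrier R" and IS: "I = Idl S"
  define n where "n = card S"
  obtain s where s: "bij_betw s {..<n} S"
    using ex_bij_betw_nat_finite[OF S(1)] unfolding n_def atLeast0LessThan by auto
  have sS: "s k \<in> S" if "k < n" for k using s that by (auto simp: bij_betw_def)
  define M where "M = mat 1 n (\<lambda>(i, k). s k)"
  have M: "M \<in> matrices_over R 1 n"
    by (rule matrices_overI) (use sS S in \<open>auto simp: M_def\<close>)
  obtain Q where Q: "nonsingular_matrix R n Q" and tri: "triangular_matrix R (matrix_mult R M Q)"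
    using triangular_reduction[OF M] by blast
  obtain P where Qc: "Q \<in> matrices_over R n n" and Pc: "P \<in> matrices_over R n n"
    and QP: "matrix_mult R Q P = identity_matrix R n"
    using Q unfolding nonsingular_matrix_def by blast
  note MQ = matrix_mult_closed[OF M Qc]
  interpret I: ideal I R by (rule I)
  have SI: "S \<subseteq> I" unfolding IS by (rule genideal_self[OF S(2)])
  \<comment> \<open>An empty set of generators gives a row without entries; the zero ideal is then
    generated by zero.\<close>
  define d where "d = (if n = 0 then \<zero> else matrix_mult R M Q $$ (0, 0))"
  have "d \<in> I"
  proof (cases "n = 0")
    case False
    have "(\<Oplus>k\<in>{..<n}. M $$ (0, k) \<otimes> Q $$ (k, 0)) \<in> I"
    proof (rule I.finsum_mem)
      show "finite {..<n}" by simp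
      show "(\<lambda>k. M $$ (0, k) \<otimes> Q $$ (k, 0)) \<in> {..<n} \<rightarrow> I"
        using sS SI False matrices_overD(3)[OF Qc] by (auto simp: M_def intro!: I.I_r_closed)
    qed
    then show ?thesis using False by (simp add: d_def matrix_mult_entry[OF M Qc])
  qed (simp add: d_def)
  have dc: "d \<in> carrier R" using \<open>d \<in> I\<close> I.Icarr by blast
  have "S \<subseteq> PIdl d"
  proof
    fix x assume "x \<in> S"
    then obtain j where j: "j < n" "x = s j" using s by (auto simp: bij_betw_def)
    have "x = M $$ (0, j)" using j by (simp add: M_def)
    also have "\<dots> = matrix_mult R (matrix_mult R M Q) P $$ (0, j)"
      by (simp add: matrix_mult_assoc[OF M Qc Pc] QP matrix_mult_identity_right[OF M])
    also have "\<dots> = (\<Oplus>k\<in>{..<n}. matrix_mult R M Q $$ (0, k) \<otimes> P $$ (k, j))"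
      using j by (intro matrix_mult_entry[OF MQ Pc]) auto
    \<comment> \<open>Triangularity kills all entries of the row \<open>M Q\<close> after the
      first.\<close>
    also have "\<dots> = matrix_mult R M Q $$ (0, 0) \<otimes> P $$ (0, j)"
    proof (rule finsum_eq_single)
      fix k assume "k \<in> {..<n}" "k \<noteq> 0"
      then have "matrix_mult R M Q $$ (0, k) = \<zero>"
        using tri unfolding triangular_matrix_def by (simp add: matrices_overD[OF MQ])
      then show "matrix_mult R M Q $$ (0, k) \<otimes> P $$ (k, j) = \<zero>"
        using matrices_overD(3)[OF Pc] \<open>k \<in> {..<n}\<close> j by simp
    qed (use j matrices_overD(3)[OF Pc] matrices_overD(3)[OF MQ] in auto)
    also have "\<dots> = P $$ (0, j) \<otimes> d"
      using j dc matrices_overD(3)[OF Pc, of 0 j] by (simp add: d_def m_comm)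
    finally show "x \<in> PIdl d"
      using j matrices_overD(3)[OF Pc, of 0 j] unfolding cgenideal_def by auto
  qed
  then have "I \<subseteq> PIdl d"
    unfolding IS by (rule genideal_minimal[OF cgenideal_ideal[OF dc]])
  moreover have "PIdl d \<subseteq> I" using cgenideal_minimal[OF I \<open>d \<in> I\<close>] .
  ultimately have "I = Idl {d}" using cgenideal_eq_genideal[OF dc] by blast
  then show "principalideal I R" using principalidealI[OF I] dc by blast
qed

section \<open>Generators of ideals, factorizations and homomorphic images\<close>

lemma (in bezout_ring) finite_generator:
  assumes "finite S" and "S \<subseteq> carrier R"
  obtains d where "d \<in> carrier R" and "Idl S = PIdl d"
  using principalideal.generate[OF finitely_generated_principal[OF genideal_ideal[OF assms(2)] assms refl]]
    cgenideal_eq_genideal by metis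

text \<open>A generator \<open>d\<close> of the ideal spanned by \<open>a\<close> and
  \<open>b\<close> divides both and is a combination of them. The cofactors need not be comaximal:
  if \<open>d\<close> is zero they are arbitrary.\<close>

lemma (in bezout_ring) pair_gcd:
  assumes a: "a \<in> carrier R" and b: "b \<in> carrier R"
  obtains d a1 b1 u v where "d \<in> carrier R" and "a1 \<in> carrier R" and "b1 \<in> carrier R"
    and "u \<in> carrier R" and "v \<in> carrier R"
    and "a = a1 \<otimes> d" and "b = b1 \<otimes> d" and "d = u \<otimes> a \<oplus> v \<otimes> b"
proof -
  have ab: "finite {a, b}" "{a, b} \<subseteq> carrier R" using a b by auto
  obtain d where d: "d \<in> carrier R" "Idl {a, b} = PIdl d"
    using finite_generator[OF ab] by blast
  then have "a \<in> PIdl d" "b \<in> PIdl d" using genideal_self[OF ab(2)] by auto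
  then obtain a1 b1 where ab1: "a1 \<in> carrier R" "b1 \<in> carrier R" "a = a1 \<otimes> d" "b = b1 \<otimes> d"
    unfolding cgenideal_def by auto
  \<comment> \<open>The sum of the two principal ideals is an ideal containing \<open>a\<close> and
    \<open>b\<close>; membership of \<open>d\<close> in it supplies \<open>u\<close> and
    \<open>v\<close>.\<close>
  have "Idl {a, b} \<subseteq> PIdl a <+>\<^bsub>R\<^esub> PIdl b"
  proof (rule genideal_minimal[OF add_ideals[OF cgenideal_ideal[OF a] cgenideal_ideal[OF b]]])
    have "\<zero> \<in> PIdl a" "\<zero> \<in> PIdl b"
      using additive_subgroup.zero_closed[OF ideal.axioms(1)[OF cgenideal_ideal]] a b by auto
    then have "a \<oplus> \<zero> \<in> PIdl a <+>\<^bsub>R\<^esub> PIdl b" "\<zero> \<oplus> b \<in> PIdl a <+>\<^bsub>R\<^esub> PIdl b"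
      using cgenideal_self a b unfolding set_add_def' by blast+
    then show "{a, b} \<subseteq> PIdl a <+>\<^bsub>R\<^esub> PIdl b" using a b by simp
  qed
  then have "d \<in> PIdl a <+>\<^bsub>R\<^esub> PIdl b" using d cgenideal_self by blast
  then obtain u v where "u \<in> carrier R" "v \<in> carrier R" "d = u \<otimes> a \<oplus> v \<otimes> b"
    unfolding set_add_def' cgenideal_def by auto
  then show thesis using that d ab1 by blast
qed

text \<open>Substituting the cofactors into \<open>d = u a + v b\<close> gives
  \<open>(u a1 + v b1) d = d\<close>, and a nonzero \<open>d\<close> cancels in a domain.\<close>

lemma unimodular_factorization_bezout_domain:
  fixes R (structure)
  assumes "domain R" and "bezout_ring R"
  shows "unimodular_factorization R"
proof -
  interpret domain R by fact
  interpret bezout_ring R by fact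
  show ?thesis
    unfolding unimodular_factorization_def
  proof (intro ballI)
    fix a b assume ab: "a \<in> carrier R" "b \<in> carrier R"
    obtain d a1 b1 u v where c: "d \<in> carrier R" "a1 \<in> carrier R" "b1 \<in> carrier R"
        "u \<in> carrier R" "v \<in> carrier R"
      and eq: "a = a1 \<otimes> d" "b = b1 \<otimes> d" "d = u \<otimes> a \<oplus> v \<otimes> b"
      by (rule pair_gcd[OF ab])
    show "\<exists>a1 \<in> carrier R. \<exists>b1 \<in> carrier R. \<exists>d \<in> carrier R. \<exists>u \<in> carrier R. \<exists>v \<in> carrier R.
       a = a1 \<otimes> d \<and> b = b1 \<otimes> d \<and> u \<otimes> a1 \<oplus> v \<otimes> b1 = \<one>"
    proof (cases "d = \<zero>")
      case True
      \<comment> \<open>Both elements are zero, so the cofactors are replaced by one and zero, with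
        coefficients one and zero.\<close>
      then have z: "a = \<one> \<otimes> \<zero>" "b = \<zero> \<otimes> \<zero>" "\<one> \<otimes> \<one> \<oplus> \<zero> \<otimes> \<zero> = \<one>"
        using eq(1,2) c True by simp_all
      show ?thesis
        by (intro bexI conjI, rule z(1), rule z(2), rule z(3)) simp_all
    next
      case False
      have "(u \<otimes> a1 \<oplus> v \<otimes> b1) \<otimes> d = u \<otimes> (a1 \<otimes> d) \<oplus> v \<otimes> (b1 \<otimes> d)"
        using c by algebra
      also have "\<dots> = d" by (simp only: eq(1,2)[symmetric] eq(3)[symmetric])
      also have "\<dots> = \<one> \<otimes> d" using c by simp
      finally have "(u \<otimes> a1 \<oplus> v \<otimes> b1) \<otimes> d = \<one> \<otimes> d" .
      moreover have "u \<otimes> a1 \<oplus> v \<otimes> b1 \<in> carrier R" using c by simp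
      ultimately have um: "u \<otimes> a1 \<oplus> v \<otimes> b1 = \<one>"
        by (simp only: m_rcancel[OF False c(1) _ one_closed])
      show ?thesis
        by (intro bexI conjI, rule eq(1), rule eq(2), rule um) (rule c)+
    qed
  qed
qed

text \<open>The property is purely equational, so \<open>h\<close> carries all five witnesses
  over.\<close>

lemma unimodular_factorization_image:
  assumes "ring R" and "h \<in> ring_hom R S" and "h ` carrier R = carrier S"
    and "unimodular_factorization R"
  shows "unimodular_factorization S"
proof -
  interpret R: ring R by fact
  show ?thesis
    unfolding unimodular_factorization_def
  proof (intro ballI)
    fix a' b' assume "a' \<in> carrier S" "b' \<in> carrier S"
    then have "a' \<in> h ` carrier R" "b' \<in> h ` carrier R" using assms(3) by simp_all
    then obtain a b where ab: "a \<in> carrier R" "b \<in> carrier R" "a' = h a" "b' = h b"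
      by (elim imageE)
    obtain a1 b1 d u v where c: "a1 \<in> carrier R" "b1 \<in> carrier R" "d \<in> carrier R"
        "u \<in> carrier R" "v \<in> carrier R"
      and eq: "a = a1 \<otimes>\<^bsub>R\<^esub> d" "b = b1 \<otimes>\<^bsub>R\<^esub> d" "u \<otimes>\<^bsub>R\<^esub> a1 \<oplus>\<^bsub>R\<^esub> v \<otimes>\<^bsub>R\<^esub> b1 = \<one>\<^bsub>R\<^esub>"
      by (rule unimodular_factorizationE[OF assms(4) ab(1,2)])
    have "h u \<otimes>\<^bsub>S\<^esub> h a1 \<oplus>\<^bsub>S\<^esub> h v \<otimes>\<^bsub>S\<^esub> h b1 = h (u \<otimes>\<^bsub>R\<^esub> a1 \<oplus>\<^bsub>R\<^esub> v \<otimes>\<^bsub>R\<^esub> b1)"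
      using c by (simp add: ring_hom_mult[OF assms(2)] ring_hom_add[OF assms(2)])
    then have um: "h u \<otimes>\<^bsub>S\<^esub> h a1 \<oplus>\<^bsub>S\<^esub> h v \<otimes>\<^bsub>S\<^esub> h b1 = \<one>\<^bsub>S\<^esub>"
      by (simp only: eq(3) ring_hom_one[OF assms(2)])
    have e: "a' = h a1 \<otimes>\<^bsub>S\<^esub> h d" "b' = h b1 \<otimes>\<^bsub>S\<^esub> h d"
      using c by (simp_all add: ab eq(1,2) ring_hom_mult[OF assms(2)])
    show "\<exists>a1 \<in> carrier S. \<exists>b1 \<in> carrier S. \<exists>d \<in> carrier S. \<exists>u \<in> carrier S. \<exists>v \<in> carrier S.
       a' = a1 \<otimes>\<^bsub>S\<^esub> d \<and> b' = b1 \<otimes>\<^bsub>S\<^esub> d \<and> u \<otimes>\<^bsub>S\<^esub> a1 \<oplus>\<^bsub>S\<^esub> v \<otimes>\<^bsub>S\<^esub> b1 = \<one>\<^bsub>S\<^esub>"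
      by (intro bexI conjI, rule e(1), rule e(2), rule um)
        (simp_all add: c ring_hom_closed[OF assms(2)])
  qed
qed

text \<open>The generators are lifted to \<open>R\<close>, where they span a principal ideal; the
  image of its generator spans the given ideal of \<open>S\<close>.\<close>

lemma bezout_ring_image:
  assumes R: "bezout_ring R" and S: "cring S"
    and h: "h \<in> ring_hom R S" and surj: "h ` carrier R = carrier S"
  shows "bezout_ring S"
proof -
  interpret R: bezout_ring R by (rule R)
  interpret S: cring S by (rule S)
  interpret hom: ring_hom_ring R S h
    by (rule ring_hom_ringI2[OF R.ring_axioms S.ring_axioms h])
  show ?thesis
  proof (rule bezout_ring.intro[OF S bezout_ring_axioms.intro])
    fix I T assume I: "ideal I S" and T: "finite T" "T \<subseteq> carrier S" and IT: "I = Idl\<^bsub>S\<^esub> T"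
    interpret I: ideal I S by (rule I)
    obtain T' where T': "T' \<subseteq> carrier R" "finite T'" "T = h ` T'"
      using finite_subset_image[of T h "carrier R"] T surj by auto
    obtain d where d: "d \<in> carrier R" "Idl\<^bsub>R\<^esub> T' = PIdl\<^bsub>R\<^esub> d"
      using R.finite_generator[OF T'(2,1)] by blast
    have hd: "h d \<in> carrier S" using d by simp
    have "T \<subseteq> PIdl\<^bsub>S\<^esub> h d"
    proof
      fix t assume "t \<in> T"
      then obtain x where x: "x \<in> T'" "t = h x" using T' by auto
      then have "x \<in> PIdl\<^bsub>R\<^esub> d" using R.genideal_self[OF T'(1)] d by auto
      then obtain r where "r \<in> carrier R" "x = r \<otimes>\<^bsub>R\<^esub> d" unfolding cgenideal_def by auto
      then show "t \<in> PIdl\<^bsub>S\<^esub> h d" unfolding cgenideal_def using x d by auto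
    qed
    then have sub: "I \<subseteq> PIdl\<^bsub>S\<^esub> h d"
      unfolding IT by (rule S.genideal_minimal[OF S.cgenideal_ideal[OF hd]])
    have "T \<subseteq> I" unfolding IT by (rule S.genideal_self[OF T(2)])
    \<comment> \<open>The preimage of \<open>I\<close> is an ideal containing the lifted generators,
      hence it contains \<open>d\<close>.\<close>
    then have "T' \<subseteq> {r \<in> carrier R. h r \<in> I}" using T' by auto
    then have "Idl\<^bsub>R\<^esub> T' \<subseteq> {r \<in> carrier R. h r \<in> I}"
      by (rule R.genideal_minimal[OF hom.ideal_vimage[OF I]])
    then have "h d \<in> I" using d R.cgenideal_self by auto
    then have "PIdl\<^bsub>S\<^esub> h d \<subseteq> I" by (rule S.cgenideal_minimal[OF I])
    with sub have "I = Idl\<^bsub>S\<^esub> {h d}" using S.cgenideal_eq_genideal[OF hd] by auto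
    then show "principalideal I S" using principalidealI[OF I] hd by blast
  qed
qed

section \<open>The amalgamation\<close>

lemma amalgamation_simps:
  "x \<otimes>\<^bsub>amalgamation A B f J\<^esub> y = (fst x \<otimes>\<^bsub>A\<^esub> fst y, snd x \<otimes>\<^bsub>B\<^esub> snd y)"
  "x \<oplus>\<^bsub>amalgamation A B f J\<^esub> y = (fst x \<oplus>\<^bsub>A\<^esub> fst y, snd x \<oplus>\<^bsub>B\<^esub> snd y)"
  "\<one>\<^bsub>amalgamation A B f J\<^esub> = (\<one>\<^bsub>A\<^esub>, \<one>\<^bsub>B\<^esub>)"
  "\<zero>\<^bsub>amalgamation A B f J\<^esub> = (\<zero>\<^bsub>A\<^esub>, \<zero>\<^bsub>B\<^esub>)"
  by (simp_all add: amalgamation_def RDirProd_def DirProd_def monoid.defs split: prod.splits)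

lemma RDirProd_simps:
  "x \<otimes>\<^bsub>RDirProd A B\<^esub> y = (fst x \<otimes>\<^bsub>A\<^esub> fst y, snd x \<otimes>\<^bsub>B\<^esub> snd y)"
  "x \<oplus>\<^bsub>RDirProd A B\<^esub> y = (fst x \<oplus>\<^bsub>A\<^esub> fst y, snd x \<oplus>\<^bsub>B\<^esub> snd y)"
  "\<one>\<^bsub>RDirProd A B\<^esub> = (\<one>\<^bsub>A\<^esub>, \<one>\<^bsub>B\<^esub>)"
  "\<zero>\<^bsub>RDirProd A B\<^esub> = (\<zero>\<^bsub>A\<^esub>, \<zero>\<^bsub>B\<^esub>)"
  by (simp_all add: RDirProd_def DirProd_def monoid.defs split: prod.splits)

lemma RDirProd_cring:
  assumes "cring A" and "cring B"
  shows "cring (RDirProd A B)"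
proof -
  interpret A: cring A by fact
  interpret B: cring B by fact
  interpret ring "RDirProd A B" by (rule RDirProd_ring[OF A.ring_axioms B.ring_axioms])
  show ?thesis
    by unfold_locales (auto simp: RDirProd_simps RDirProd_carrier A.m_comm B.m_comm)
qed

lemma RDirProd_a_inv:
  assumes "ring A" and "ring B" and "x \<in> carrier (RDirProd A B)"
  shows "\<ominus>\<^bsub>RDirProd A B\<^esub> x = (\<ominus>\<^bsub>A\<^esub> fst x, \<ominus>\<^bsub>B\<^esub> snd x)"
proof -
  interpret A: ring A by fact
  interpret B: ring B by fact
  interpret ring "RDirProd A B" by (rule RDirProd_ring[OF assms(1,2)])
  show ?thesis
    by (rule minus_equality)
      (use assms(3) in \<open>auto simp: RDirProd_simps RDirProd_carrier A.l_neg B.l_neg\<close>)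
qed

section \<open>The amalgamation as a subring of the product\<close>

locale ring_amalgamation = ring_hom_cring A B f + J: ideal J B
  for A (structure) and B (structure) and f and J
begin

text \<open>Replaces the parametrization by \<open>j\<close> with the congruence of \<open>b\<close>
  and \<open>f a\<close> modulo \<open>J\<close>, so that closure properties become computations
  with congruences.\<close>

lemma mem_amalgamation_iff:
  "(a, b) \<in> carrier (amalgamation A B f J) \<longleftrightarrow>
     a \<in> carrier A \<and> b \<in> carrier B \<and> b \<ominus>\<^bsub>B\<^esub> f a \<in> J"
proof
  assume "(a, b) \<in> carrier (amalgamation A B f J)"
  then obtain j where j: "a \<in> carrier A" "j \<in> J" "b = f a \<oplus>\<^bsub>B\<^esub> j"
    unfolding amalgamation_def by auto
  then have c: "j \<in> carrier B" "f a \<in> carrier B" using J.Icarr by auto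
  then have "b \<ominus>\<^bsub>B\<^esub> f a = j" unfolding j by algebra
  then show "a \<in> carrier A \<and> b \<in> carrier B \<and> b \<ominus>\<^bsub>B\<^esub> f a \<in> J" using j c by simp
next
  assume *: "a \<in> carrier A \<and> b \<in> carrier B \<and> b \<ominus>\<^bsub>B\<^esub> f a \<in> J"
  then have "f a \<in> carrier B" "b \<in> carrier B" by auto
  then have "b = f a \<oplus>\<^bsub>B\<^esub> (b \<ominus>\<^bsub>B\<^esub> f a)" by algebra
  then show "(a, b) \<in> carrier (amalgamation A B f J)"
    using * unfolding amalgamation_def by auto
qed

lemma mem_amalgamation_improper:
  assumes "J = carrier B"
  shows "(a, b) \<in> carrier (amalgamation A B f J) \<longleftrightarrow> a \<in> carrier A \<and> b \<in> carrier B"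
  unfolding mem_amalgamation_iff using assms S.minus_closed hom_closed by blast

lemma amalgamation_cring: "cring (amalgamation A B f J)"
proof -
  interpret P: cring "RDirProd A B" by (rule RDirProd_cring[OF R.is_cring S.is_cring])
  let ?C = "carrier (amalgamation A B f J)"
  have "subring ?C (RDirProd A B)"
  proof (rule P.subringI)
    show "?C \<subseteq> carrier (RDirProd A B)"
      by (auto simp: RDirProd_carrier mem_amalgamation_iff)
    show "\<one>\<^bsub>RDirProd A B\<^esub> \<in> ?C"
      by (simp add: RDirProd_simps mem_amalgamation_iff S.minus_eq S.r_neg)
  next
    fix h assume "h \<in> ?C"
    then obtain a b where h: "h = (a, b)" "a \<in> carrier A" "b \<in> carrier B" "b \<ominus>\<^bsub>B\<^esub> f a \<in> J"
      using mem_amalgamation_iff by (cases h) auto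
    then have "f a \<in> carrier B" by simp
    then have "\<ominus>\<^bsub>B\<^esub> b \<ominus>\<^bsub>B\<^esub> (\<ominus>\<^bsub>B\<^esub> f a) = \<ominus>\<^bsub>B\<^esub> (b \<ominus>\<^bsub>B\<^esub> f a)" using h by algebra
    then have "\<ominus>\<^bsub>B\<^esub> b \<ominus>\<^bsub>B\<^esub> f (\<ominus>\<^bsub>A\<^esub> a) \<in> J" using h J.a_inv_closed by simp
    then show "\<ominus>\<^bsub>RDirProd A B\<^esub> h \<in> ?C"
      using h by (simp add: RDirProd_a_inv R.ring_axioms S.ring_axioms RDirProd_carrier mem_amalgamation_iff)
  next
    fix h h' assume "h \<in> ?C" "h' \<in> ?C"
    then obtain a b a' b' where h: "h = (a, b)" "a \<in> carrier A" "b \<in> carrier B" "b \<ominus>\<^bsub>B\<^esub> f a \<in> J"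
      and h': "h' = (a', b')" "a' \<in> carrier A" "b' \<in> carrier B" "b' \<ominus>\<^bsub>B\<^esub> f a' \<in> J"
      using mem_amalgamation_iff by (cases h, cases h') auto
    have c: "f a \<in> carrier B" "f a' \<in> carrier B" using h h' by simp_all
    have "(b \<oplus>\<^bsub>B\<^esub> b') \<ominus>\<^bsub>B\<^esub> (f a \<oplus>\<^bsub>B\<^esub> f a') = (b \<ominus>\<^bsub>B\<^esub> f a) \<oplus>\<^bsub>B\<^esub> (b' \<ominus>\<^bsub>B\<^esub> f a')"
      using c h(3) h'(3) by algebra
    then show "h \<oplus>\<^bsub>RDirProd A B\<^esub> h' \<in> ?C"
      using h h' J.a_closed by (simp add: RDirProd_simps mem_amalgamation_iff)
    \<comment> \<open>The mixed term \<open>b f(a')\<close> is subtracted and added.\<close>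
    have "(b \<otimes>\<^bsub>B\<^esub> b') \<ominus>\<^bsub>B\<^esub> (f a \<otimes>\<^bsub>B\<^esub> f a') =
        b \<otimes>\<^bsub>B\<^esub> (b' \<ominus>\<^bsub>B\<^esub> f a') \<oplus>\<^bsub>B\<^esub> f a' \<otimes>\<^bsub>B\<^esub> (b \<ominus>\<^bsub>B\<^esub> f a)"
      using c h(3) h'(3) by algebra
    then show "h \<otimes>\<^bsub>RDirProd A B\<^esub> h' \<in> ?C"
      using h h' c J.a_closed J.I_l_closed by (simp add: RDirProd_simps mem_amalgamation_iff)
  qed
  then have "cring (RDirProd A B\<lparr>carrier := ?C\<rparr>)"
    using P.subcring_iff[OF subringE(1)] P.subcringI' by blast
  then show ?thesis by (simp add: amalgamation_def)
qed

section \<open>The two projections\<close>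

lemma fst_hom: "fst \<in> ring_hom (amalgamation A B f J) A"
  by (rule ring_hom_memI) (auto simp: amalgamation_simps mem_amalgamation_iff)

lemma snd_hom: "snd \<in> ring_hom (amalgamation A B f J) B"
  by (rule ring_hom_memI) (auto simp: amalgamation_simps mem_amalgamation_iff)

text \<open>The amalgamation contains the graph of \<open>f\<close>.\<close>

lemma fst_surj: "fst ` carrier (amalgamation A B f J) = carrier A"
proof -
  have "(a, f a) \<in> carrier (amalgamation A B f J)" if "a \<in> carrier A" for a
    using that by (simp add: mem_amalgamation_iff S.minus_eq S.r_neg)
  then have "carrier A \<subseteq> fst ` carrier (amalgamation A B f J)"
    by (metis fst_conv imageI subsetI)
  then show ?thesis using ring_hom_closed[OF fst_hom] by blast
qed

lemma snd_image: "snd ` carrier (amalgamation A B f J) = carrier (image_plus_ideal A B f J)"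
proof -
  have "snd ` {(a, f a \<oplus>\<^bsub>B\<^esub> j) | a j. a \<in> carrier A \<and> j \<in> J}
      = {f a \<oplus>\<^bsub>B\<^esub> j | a j. a \<in> carrier A \<and> j \<in> J}"
    by (simp add: setcompr_eq_image image_Collect)
  then show ?thesis by (simp add: amalgamation_def image_plus_ideal_def)
qed

lemma image_plus_ideal_subcring: "subcring (carrier (image_plus_ideal A B f J)) B"
proof -
  interpret am: cring "amalgamation A B f J" by (rule amalgamation_cring)
  interpret snd: ring_hom_ring "amalgamation A B f J" B snd
    by (rule ring_hom_ringI2[OF am.ring_axioms S.ring_axioms snd_hom])
  have "subring (snd ` carrier (amalgamation A B f J)) B"
    by (rule snd.img_is_subring[OF am.carrier_is_subring])
  then show ?thesis using snd_image S.subcringI' by metis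
qed

lemma image_plus_ideal_cring: "cring (image_plus_ideal A B f J)"
proof -
  have "cring (B\<lparr>carrier := carrier (image_plus_ideal A B f J)\<rparr>)"
    by (rule iffD1[OF S.subcring_iff[OF subcringE(1)]])
      (rule image_plus_ideal_subcring)+
  then show ?thesis by (simp add: image_plus_ideal_def)
qed

lemma snd_hom_image: "snd \<in> ring_hom (amalgamation A B f J) (image_plus_ideal A B f J)"
proof (rule ring_hom_memI)
  show "snd x \<in> carrier (image_plus_ideal A B f J)" if "x \<in> carrier (amalgamation A B f J)" for x
    using that snd_image by blast
qed (simp_all add: amalgamation_simps image_plus_ideal_def)

text \<open>If \<open>(a, b)\<close> and \<open>(a', b)\<close> both belong to the amalgamation,
  then \<open>f a - f a'\<close> lies in \<open>J\<close> and in the image of \<open>f\<close>,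
  hence is zero.\<close>

lemma snd_iso:
  assumes "inj_on f (carrier A)" and "f ` carrier A \<inter> J = {\<zero>\<^bsub>B\<^esub>}"
  shows "snd \<in> ring_iso (amalgamation A B f J) (image_plus_ideal A B f J)"
proof -
  have "a = a'" if "(a, b) \<in> carrier (amalgamation A B f J)"
      "(a', b) \<in> carrier (amalgamation A B f J)" for a a' b
  proof -
    have ab: "a \<in> carrier A" "a' \<in> carrier A" "b \<in> carrier B"
        "b \<ominus>\<^bsub>B\<^esub> f a \<in> J" "b \<ominus>\<^bsub>B\<^esub> f a' \<in> J"
      using that by (simp_all add: mem_amalgamation_iff)
    have c: "f a \<in> carrier B" "f a' \<in> carrier B" using ab by simp_all
    have "(b \<ominus>\<^bsub>B\<^esub> f a') \<oplus>\<^bsub>B\<^esub> (\<ominus>\<^bsub>B\<^esub> (b \<ominus>\<^bsub>B\<^esub> f a)) \<in> J"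
      using ab J.a_closed J.a_inv_closed by blast
    also have "(b \<ominus>\<^bsub>B\<^esub> f a') \<oplus>\<^bsub>B\<^esub> (\<ominus>\<^bsub>B\<^esub> (b \<ominus>\<^bsub>B\<^esub> f a)) = f a \<ominus>\<^bsub>B\<^esub> f a'"
      using c ab(3) by algebra
    finally have J: "f a \<ominus>\<^bsub>B\<^esub> f a' \<in> J" .
    have "f a \<ominus>\<^bsub>B\<^esub> f a' = f (a \<ominus>\<^bsub>A\<^esub> a')"
      using ab by (simp add: R.minus_eq S.minus_eq)
    then have "f a \<ominus>\<^bsub>B\<^esub> f a' \<in> f ` carrier A"
      using R.minus_closed[OF ab(1,2)] by (rule image_eqI)
    with J have "f a \<ominus>\<^bsub>B\<^esub> f a' = \<zero>\<^bsub>B\<^esub>"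
      using assms(2) by blast
    then have "f a = f a'" using c by simp
    then show ?thesis using inj_onD[OF assms(1)] ab by blast
  qed
  then have "inj_on snd (carrier (amalgamation A B f J))"
    unfolding inj_on_def by auto
  then show ?thesis
    using snd_hom_image snd_image by (simp add: ring_iso_def bij_betw_def)
qed

text \<open>For \<open>J = carrier B\<close> every pair belongs to the amalgamation, so
  factorizations in \<open>A\<close> and \<open>B\<close> can be paired freely.\<close>

lemma unimodular_factorization_product:
  assumes "J = carrier B" and "unimodular_factorization A" and "unimodular_factorization B"
  shows "unimodular_factorization (amalgamation A B f J)"
  unfolding unimodular_factorization_def
proof (intro ballI)
  note C = mem_amalgamation_improper[OF assms(1)]
  fix x y assume "x \<in> carrier (amalgamation A B f J)" "y \<in> carrier (amalgamation A B f J)"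
  then obtain a b a' b' where xy: "x = (a, b)" "y = (a', b')" "a \<in> carrier A" "a' \<in> carrier A"
      "b \<in> carrier B" "b' \<in> carrier B"
    using C by (cases x, cases y) auto
  obtain p q d u v where A: "p \<in> carrier A" "q \<in> carrier A" "d \<in> carrier A" "u \<in> carrier A"
      "v \<in> carrier A" "a = p \<otimes>\<^bsub>A\<^esub> d" "a' = q \<otimes>\<^bsub>A\<^esub> d" "u \<otimes>\<^bsub>A\<^esub> p \<oplus>\<^bsub>A\<^esub> v \<otimes>\<^bsub>A\<^esub> q = \<one>\<^bsub>A\<^esub>"
    by (rule unimodular_factorizationE[OF assms(2) xy(3,4)])
  obtain p' q' d' u' v' where B: "p' \<in> carrier B" "q' \<in> carrier B" "d' \<in> carrier B"
      "u' \<in> carrier B" "v' \<in> carrier B" "b = p' \<otimes>\<^bsub>B\<^esub> d'" "b' = q' \<otimes>\<^bsub>B\<^esub> d'"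
      "u' \<otimes>\<^bsub>B\<^esub> p' \<oplus>\<^bsub>B\<^esub> v' \<otimes>\<^bsub>B\<^esub> q' = \<one>\<^bsub>B\<^esub>"
    by (rule unimodular_factorizationE[OF assms(3) xy(5,6)])
  let ?R = "amalgamation A B f J"
  have "(p, p') \<in> carrier ?R" "(q, q') \<in> carrier ?R" "(d, d') \<in> carrier ?R"
    "(u, u') \<in> carrier ?R" "(v, v') \<in> carrier ?R"
    using C A B by simp_all
  moreover have "x = (p, p') \<otimes>\<^bsub>?R\<^esub> (d, d')" "y = (q, q') \<otimes>\<^bsub>?R\<^esub> (d, d')"
      "(u, u') \<otimes>\<^bsub>?R\<^esub> (p, p') \<oplus>\<^bsub>?R\<^esub> (v, v') \<otimes>\<^bsub>?R\<^esub> (q, q') = \<one>\<^bsub>?R\<^esub>"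
    using xy A B by (simp_all add: amalgamation_simps)
  ultimately show "\<exists>a1 \<in> carrier ?R. \<exists>b1 \<in> carrier ?R. \<exists>d \<in> carrier ?R. \<exists>u \<in> carrier ?R.
      \<exists>v \<in> carrier ?R. x = a1 \<otimes>\<^bsub>?R\<^esub> d \<and> y = b1 \<otimes>\<^bsub>?R\<^esub> d \<and>
      u \<otimes>\<^bsub>?R\<^esub> a1 \<oplus>\<^bsub>?R\<^esub> v \<otimes>\<^bsub>?R\<^esub> b1 = \<one>\<^bsub>?R\<^esub>"
    by (intro bexI conjI)
qed

text \<open>
  A generator \<open>(d, e)\<close> of the ideal spanned by \<open>(a, 0)\<close> and \<open>(0, f a)\<close> has nonzero components,
  so that \<open>(a, 0) = (u, 0) (d, e)\<close> with \<open>f u \<in> J\<close>; and since \<open>d\<close> is a multiple of \<open>a\<close>,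
  \<open>u\<close> is a unit.
\<close>

lemma ideal_improper_if_bezout:
  assumes "domain A" and "domain B" and inj: "inj_on f (carrier A)"
    and bez: "bezout_ring (amalgamation A B f J)"
    and a: "a \<in> carrier A" "a \<noteq> \<zero>\<^bsub>A\<^esub>" "f a \<in> J"
  shows "J = carrier B"
proof -
  interpret A: domain A by fact
  interpret B: domain B by fact
  let ?R = "amalgamation A B f J"
  have fa: "f a \<in> carrier B" using a by simp
  have "f a \<noteq> \<zero>\<^bsub>B\<^esub>" using inj a inj_on_eq_iff[OF inj, of a "\<zero>\<^bsub>A\<^esub>"] by simp
  \<comment> \<open>Both memberships rest on \<open>f a \<in> J\<close>: the differences in question
    are \<open>- f a\<close> and \<open>f a\<close>.\<close>
  have mem: "(a, \<zero>\<^bsub>B\<^esub>) \<in> carrier ?R" "(\<zero>\<^bsub>A\<^esub>, f a) \<in> carrier ?R"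
    using a fa J.a_inv_closed[OF a(3)] by (simp_all add: mem_amalgamation_iff S.minus_eq)
  obtain D X Y U V where c: "D \<in> carrier ?R" "X \<in> carrier ?R" "Y \<in> carrier ?R"
      "U \<in> carrier ?R" "V \<in> carrier ?R"
    and eq: "(a, \<zero>\<^bsub>B\<^esub>) = X \<otimes>\<^bsub>?R\<^esub> D" "(\<zero>\<^bsub>A\<^esub>, f a) = Y \<otimes>\<^bsub>?R\<^esub> D"
      "D = U \<otimes>\<^bsub>?R\<^esub> (a, \<zero>\<^bsub>B\<^esub>) \<oplus>\<^bsub>?R\<^esub> V \<otimes>\<^bsub>?R\<^esub> (\<zero>\<^bsub>A\<^esub>, f a)"
    by (rule bezout_ring.pair_gcd[OF bez mem])
  obtain d e where D: "D = (d, e)" by (cases D)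
  obtain u v where X: "X = (u, v)" by (cases X)
  obtain x x' where U: "U = (x, x')" by (cases U)
  obtain z z' where V: "V = (z, z')" by (cases V)
  have cc: "d \<in> carrier A" "u \<in> carrier A" "x \<in> carrier A" "z \<in> carrier A"
      "e \<in> carrier B" "v \<in> carrier B" "v \<ominus>\<^bsub>B\<^esub> f u \<in> J"
    using c D X U V by (auto simp: mem_amalgamation_iff)
  have sY: "snd Y \<in> carrier B" using c(3) by (cases Y) (auto simp: mem_amalgamation_iff)
  have aud: "a = u \<otimes>\<^bsub>A\<^esub> d" and ve: "\<zero>\<^bsub>B\<^esub> = v \<otimes>\<^bsub>B\<^esub> e" and fae: "f a = snd Y \<otimes>\<^bsub>B\<^esub> e"
    using eq(1,2) D X by (simp_all add: amalgamation_simps)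
  have "e \<noteq> \<zero>\<^bsub>B\<^esub>" using fae \<open>f a \<noteq> \<zero>\<^bsub>B\<^esub>\<close> sY by auto
  then have "v = \<zero>\<^bsub>B\<^esub>" using ve cc B.integral_iff by metis
  \<comment> \<open>The multiple of \<open>(0, f a)\<close> contributes nothing to the first
    component.\<close>
  have dxa: "d = x \<otimes>\<^bsub>A\<^esub> a"
    using eq(3) D U V cc a by (simp add: amalgamation_simps)
  have "(x \<otimes>\<^bsub>A\<^esub> u) \<otimes>\<^bsub>A\<^esub> d = x \<otimes>\<^bsub>A\<^esub> a"
    using cc by (simp add: R.m_assoc aud[symmetric])
  then have "(x \<otimes>\<^bsub>A\<^esub> u) \<otimes>\<^bsub>A\<^esub> d = \<one>\<^bsub>A\<^esub> \<otimes>\<^bsub>A\<^esub> d"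
    using dxa cc(1) by simp
  moreover have "d \<noteq> \<zero>\<^bsub>A\<^esub>" using aud a cc by auto
  moreover have "x \<otimes>\<^bsub>A\<^esub> u \<in> carrier A" using cc by simp
  ultimately have "x \<otimes>\<^bsub>A\<^esub> u = \<one>\<^bsub>A\<^esub>"
    using A.m_rcancel[OF _ cc(1) _ R.one_closed] by blast
  then have "f x \<otimes>\<^bsub>B\<^esub> f u = \<one>\<^bsub>B\<^esub>" using cc hom_mult[of x u] by simp
  moreover have "f u \<in> J"
    using J.a_inv_closed[OF cc(7)] cc \<open>v = \<zero>\<^bsub>B\<^esub>\<close> by (simp add: S.minus_eq)
  ultimately have "\<one>\<^bsub>B\<^esub> \<in> J" using J.I_l_closed[of "f u" "f x"] cc by simp
  then show ?thesis by (rule J.one_imp_carrier)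
qed

end

theorem theorem2p9:
  fixes A :: "('a, 'm) ring_scheme" and B :: "('b, 'n) ring_scheme"
    and f :: "'a \<Rightarrow> 'b" and J :: "'b set"
  assumes "domain A" and "domain B" and "ideal J B"
    and "f \<in> ring_hom A B" and "inj_on f (carrier A)"
  shows "(hermite_ring (amalgamation A B f J) \<longleftrightarrow> bezout_ring (amalgamation A B f J)) \<and>
         (bezout_ring (amalgamation A B f J) \<longleftrightarrow>
            (J = carrier B \<and> bezout_ring A \<and> bezout_ring B) \<or>
            (J \<noteq> carrier B \<and> f ` carrier A \<inter> J = {\<zero>\<^bsub>B\<^esub>} \<and>
               bezout_ring (image_plus_ideal A B f J)))"
    (is "(?H \<longleftrightarrow> ?Z) \<and> (?Z \<longleftrightarrow> ?C)")
proof -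
  interpret A: domain A by fact
  interpret B: domain B by fact
  interpret J: ideal J B by fact
  interpret ring_amalgamation A B f J
    by unfold_locales (rule assms(4))
  let ?R = "amalgamation A B f J" and ?P = "image_plus_ideal A B f J"
  \<comment> \<open>The implications form a cycle: Hermite, Bezout, the case distinction, and back
    to Hermite.\<close>
  have "?Z" if "?H" using hermite_ring.bezout_ring[OF that] .
  moreover have "?C" if Z: "?Z"
  proof (cases "J = carrier B")
    case True
    \<comment> \<open>The pair \<open>(0, b)\<close> shows that the second projection is onto
      \<open>B\<close>.\<close>
    have "b \<in> snd ` carrier ?R" if "b \<in> carrier B" for b
      using that mem_amalgamation_improper[OF True, of "\<zero>\<^bsub>A\<^esub>" b] A.zero_closed
      by (metis imageI snd_conv)
    then have "snd ` carrier ?R = carrier B"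
      using ring_hom_closed[OF snd_hom] by blast
    then show ?thesis
      using True bezout_ring_image[OF Z A.is_cring fst_hom fst_surj]
        bezout_ring_image[OF Z B.is_cring snd_hom] by blast
  next
    case False
    \<comment> \<open>A nonzero \<open>f a\<close> in \<open>J\<close> would come from a nonzero
      \<open>a\<close> and force \<open>J = carrier B\<close>.\<close>
    have "f a = \<zero>\<^bsub>B\<^esub>" if "a \<in> carrier A" "f a \<in> J" for a
      using ideal_improper_if_bezout[OF assms(1,2,5) Z that(1) _ that(2)] False by fastforce
    moreover have "\<zero>\<^bsub>B\<^esub> \<in> f ` carrier A"
      using A.zero_closed hom_zero by (metis imageI)
    ultimately have "f ` carrier A \<inter> J = {\<zero>\<^bsub>B\<^esub>}" using J.zero_closed by blast
    then show ?thesis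
      using False bezout_ring_image[OF Z image_plus_ideal_cring snd_hom_image snd_image] by blast
  qed
  moreover have "?H" if C: "?C"
  proof -
    have "unimodular_factorization ?R"
      using C
    proof (elim disjE conjE)
      assume "J = carrier B" "bezout_ring A" "bezout_ring B"
      then show ?thesis
        by (intro unimodular_factorization_product unimodular_factorization_bezout_domain assms(1,2))
    next
      assume "f ` carrier A \<inter> J = {\<zero>\<^bsub>B\<^esub>}" and P: "bezout_ring ?P"
      \<comment> \<open>The inverse of the projection is taken because the factorization property is
        to be carried from \<open>?P\<close> to \<open>?R\<close>.\<close>
      then have iso: "inv_into (carrier ?R) snd \<in> ring_iso ?P ?R"
        by (intro ring_iso_set_sym[OF cring.axioms(1)[OF amalgamation_cring]] snd_iso[OF assms(5)])
      \<comment> \<open>As a subring of \<open>B\<close>, the ring \<open>?P\<close> has no zero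
        divisors, so its Bezout property yields factorizations.\<close>
      have "subdomain (carrier ?P) B"
        by (rule B.subdomainI'[OF subcring.axioms(1)[OF image_plus_ideal_subcring]])
      then have "domain (B\<lparr>carrier := carrier ?P\<rparr>)"
        using B.subdomain_iff[OF subcringE(1)[OF image_plus_ideal_subcring]] by simp
      then have "domain ?P" by (simp add: image_plus_ideal_def)
      show ?thesis
      proof (rule unimodular_factorization_image)
        show "ring ?P" by (rule cring.axioms(1)[OF image_plus_ideal_cring])
        show "inv_into (carrier ?R) snd \<in> ring_hom ?P ?R"
          "inv_into (carrier ?R) snd ` carrier ?P = carrier ?R"
          using iso unfolding ring_iso_def bij_betw_def by simp_all
        show "unimodular_factorization ?P"
          by (rule unimodular_factorization_bezout_domain[OF \<open>domain ?P\<close> P])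
      qed
    qed
    then show ?thesis
      by (rule cring.hermite_ring_if_unimodular_factorization[OF amalgamation_cring])
  qed
  ultimately show ?thesis by blast
qed

end
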